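(* Let $k\geq 2$ be an integer and let $\alpha\in[1/k,1/2]$ be a constant such that the real number \[ (1-2\alpha)\log\frac{1}{1-2\alpha}-\alpha\log(\alpha^2k)-2\alpha\log\left(\frac{2}{1+\sqrt{1-1/k}}\right)+(1-2\alpha)\log(1-1/k) \] is negative. Then $\mathrm{LT}(k,n)\leq\alpha n$ for all sufficiently large $n$. In particular, $\mathrm{LT}(4,n)\leq 0.4932n$ and $\mathrm{LT}(5,n)\leq 0.48n$ for all sufficiently large $n$, and for all large $k$, \[ \mathrm{LT}(k,n)\leq\left(\frac{e}{\sqrt{k}}-\frac{e^2+1/2}{k}+O(k^{-3/2})\right)n+o(n). \]
   Context: $\log$ denotes the natural logarithm (with the convention $0\log\frac{1}{0}=0$). For a positive integer $k$ let $[k]=\{1,\dots,k\}$. A subsequence of a word $w\in[k]^n$ is a word formed by letters of $w$ at positions $i_1<\dots<i_m$. Two subsequences of $w$ are called twins if they are equal as words and no position of $w$ is used in both. $\mathrm{LT}(w)$ is the maximum length of twins in $w$, and $\mathrm{LT}(k,n)=\min_{w\in[k]^n}\mathrm{LT}(w)$. *)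

theory Defs
  imports "HOL-Analysis.Analysis"
begin

definition has_twins :: "nat list \<Rightarrow> nat \<Rightarrow> bool" where
  "has_twins w m \<longleftrightarrow> (\<exists>I J. I \<subseteq> {..<length w} \<and> J \<subseteq> {..<length w} \<and> I \<inter> J = {}
      \<and> card I = m \<and> card J = m \<and> nths w I = nths w J)"

definition LT :: "nat list \<Rightarrow> nat" where
  "LT w = Max {m. has_twins w m}"

definition words :: "nat \<Rightarrow> nat \<Rightarrow> nat list set" where
  "words k n = {w. length w = n \<and> set w \<subseteq> {1..k}}"

definition LTkn :: "nat \<Rightarrow> nat \<Rightarrow> nat" where
  "LTkn k n = Min (LT ` words k n)"

definition twin_expr :: "nat \<Rightarrow> real \<Rightarrow> real" where
  "twin_expr k a =
     (if a = 1/2 then 0 else (1 - 2*a) * ln (1 / (1 - 2*a)))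
     - a * ln (a^2 * real k)
     - 2*a * ln (2 / (1 + sqrt (1 - 1 / real k)))
     + (1 - 2*a) * ln (1 - 1 / real k)"

end

theory Submission
  imports Defs "HOL-Real_Asymp.Real_Asymp"
begin

text \<open>
  First moment method over canonical twins. Among all pairs of twins of length \<open>m\<close> in a word, take
  the one whose label word (unused, first twin, second twin) is lexicographically minimal. Then every
  unused letter after the first used one differs from the last used letter, the first twin always
  leads, and a letter of the first twin directly following one of the second twin (among the used
  letters) differs from it. The words together with such labellings are counted by a weighted
  transfer argument; the third condition replaces the factor \<open>4 ^ m\<close> for distributing the used
  positions among the twins by \<open>(1 + sqrt (1 - 1/k)) ^ (2 * m)\<close>. If the count is less than
  \<open>k ^ n\<close>, some word has no twins of length \<open>m\<close>.
\<close>

section \<open>Twins as labellings of a word\<close>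

definition pick :: "nat \<Rightarrow> (nat \<times> nat) list \<Rightarrow> nat list" where
  "pick c v = map fst (filter (\<lambda>p. snd p = c) v)"

lemma pick_simps [simp]:
  "pick c [] = []"
  "pick c (p # v) = (if snd p = c then fst p # pick c v else pick c v)"
  "pick c (u @ v) = pick c u @ pick c v"
  by (auto simp: pick_def)

lemma pick_eq_Nil: "(\<And>p. p \<in> set v \<Longrightarrow> snd p \<noteq> c) \<Longrightarrow> pick c v = []"
  by (auto simp: pick_def)

text \<open>A pair of twins is encoded by labelling the letters of the word: label 1 for the positions of
  the first twin, 2 for those of the second, 0 for unused positions.\<close>

definition twin_labelling :: "nat list \<Rightarrow> nat \<Rightarrow> (nat \<times> nat) list \<Rightarrow> bool" where
  "twin_labelling w m v \<longleftrightarrow> map fst v = w \<and> snd ` set v \<subseteq> {0, 1, 2}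
     \<and> pick 1 v = pick 2 v \<and> length (pick 1 v) = m"

text \<open>Each position is labelled by its membership in \<open>I\<close> or \<open>J\<close>.
  Disjointness makes label 2 mean exactly \<open>J\<close>, so \<open>pick\<close> recovers both
  twins.\<close>

lemma has_twins_imp_labelling:
  assumes "has_twins w m"
  shows "\<exists>v. twin_labelling w m v"
proof -
  obtain I J where IJ: "I \<subseteq> {..<length w}" "I \<inter> J = {}" "card I = m" "nths w I = nths w J"
    using assms by (auto simp: has_twins_def)
  define lab :: "nat \<Rightarrow> nat" where "lab i = (if i \<in> I then 1 else if i \<in> J then 2 else 0)" for i
  define v where "v = map (\<lambda>p. (fst p, lab (snd p))) (zip w [0..<length w])"
  have 1: "pick 1 v = nths w I"
    unfolding pick_def v_def nths_def by (simp add: filter_map o_def lab_def)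
  have "lab i = 2 \<longleftrightarrow> i \<in> J" for i
    using IJ(2) by (auto simp: lab_def)
  then have 2: "pick 2 v = nths w J"
    unfolding pick_def v_def nths_def by (simp add: filter_map o_def)
  have "{i. i < length w \<and> i \<in> I} = I"
    using IJ(1) by auto
  then have "length (nths w I) = m"
    using IJ(3) by (simp add: length_nths)
  moreover have "map fst v = w"
    by (simp add: v_def o_def map_fst_zip)
  moreover have "snd ` set v \<subseteq> {0, 1, 2}"
    by (auto simp: v_def lab_def split: if_splits)
  ultimately show ?thesis
    using 1 2 IJ(4) by (auto simp: twin_labelling_def)
qed

text \<open>Shortens one twin to a prefix without touching the word or the other twin; thus twins of
  length at least \<open>m\<close> give twins of length exactly \<open>m\<close>.\<close>

fun unlabel_after :: "nat \<Rightarrow> nat \<Rightarrow> (nat \<times> nat) list \<Rightarrow> (nat \<times> nat) list" where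
  "unlabel_after c m [] = []"
| "unlabel_after c m ((x, l) # v) =
    (if l \<noteq> c then (x, l) # unlabel_after c m v
     else if m = 0 then (x, 0) # unlabel_after c 0 v
     else (x, l) # unlabel_after c (m - 1) v)"

lemma map_fst_unlabel_after [simp]: "map fst (unlabel_after c m v) = map fst v"
  by (induction c m v rule: unlabel_after.induct) auto

lemma set_unlabel_after: "p \<in> set (unlabel_after c m v) \<Longrightarrow> p \<in> set v \<or> snd p = 0"
  by (induction c m v rule: unlabel_after.induct) (auto split: if_splits)

lemma pick_unlabel_after_same:
  "c \<noteq> 0 \<Longrightarrow> pick c (unlabel_after c m v) = take m (pick c v)"
  by (induction c m v rule: unlabel_after.induct) (auto simp: take_Cons')

lemma pick_unlabel_after_other:
  "d \<noteq> c \<Longrightarrow> d \<noteq> 0 \<Longrightarrow> pick d (unlabel_after c m v) = pick d v"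
  by (induction c m v rule: unlabel_after.induct) auto

lemma twin_labelling_mono:
  assumes "twin_labelling w m v" "m' \<le> m"
  shows "twin_labelling w m' (unlabel_after 1 m' (unlabel_after 2 m' v))"
proof -
  have "snd ` set (unlabel_after 1 m' (unlabel_after 2 m' v)) \<subseteq> {0, 1, 2}"
    using assms(1) by (auto simp: twin_labelling_def dest!: set_unlabel_after)
  then show ?thesis
    using assms by (auto simp: twin_labelling_def pick_unlabel_after_same pick_unlabel_after_other)
qed

section \<open>Lexicographically minimal labellings\<close>

text \<open>The local conditions met by a lexicographically minimal labelling, read from left to right.
  The state consists of the letters of the first twin that the second one has yet to match (so that
  a letter labelled 2 is forced) and of the last used letter with its label. Violating a condition
  allows one to decrease the label word: an unused letter equal to the last used letter can take
  over its role; equal letters labelled 2, 1 that are consecutive among the used ones can exchange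
  their labels; and when the second twin overtakes the first, all labels 1 and 2 can be exchanged
  from there on.\<close>

fun canonical :: "nat list \<Rightarrow> (nat \<times> nat) option \<Rightarrow> (nat \<times> nat) list \<Rightarrow> bool" where
  "canonical q s [] = True"
| "canonical q s ((x, l) # v) =
    (if l = 0 then (\<forall>y c. s = Some (y, c) \<longrightarrow> x \<noteq> y) \<and> canonical q s v
     else if l = 1 then (\<forall>y. s = Some (y, 2) \<longrightarrow> x \<noteq> y) \<and> canonical (q @ [x]) (Some (x, 1)) v
     else l = 2 \<and> q \<noteq> [] \<and> x = hd q \<and> canonical (tl q) (Some (x, 2)) v)"

text \<open>The order \<open>lex\<close> relates only lists of equal length, which is also what
  makes it well-founded.\<close>

lemma lex_less_thanI:
  "length ys = length zs \<Longrightarrow> a < b \<Longrightarrow> (xs @ a # ys, xs @ b # zs) \<in> lex less_than"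
  by (auto simp: lex_conv)

definition swap_label :: "nat \<Rightarrow> nat" where
  "swap_label l = (if l = 1 then 2 else if l = 2 then 1 else l)"

lemma pick_swap_label:
  "pick 1 (map (apsnd swap_label) v) = pick 2 v"
  "pick 2 (map (apsnd swap_label) v) = pick 1 v"
  by (induction v) (auto simp: swap_label_def)

lemma minimal_imp_canonical:
  assumes lab: "twin_labelling w m v"
    and min: "\<And>v'. twin_labelling w m v' \<Longrightarrow> (map snd v', map snd v) \<notin> lex less_than"
    and v: "v = us @ ws"
    and q: "pick 1 us = pick 2 us @ q"
    and s: "s = None \<or> (\<exists>us' y l ns. s = Some (y, l) \<and> us = us' @ (y, l) # ns \<and>
              l \<noteq> 0 \<and> (\<forall>p\<in>set ns. snd p = 0))"
  shows "canonical q s ws"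
  using v q s
proof (induction ws arbitrary: us q s)
  case Nil
  then show ?case by simp
next
  case (Cons p ws)
  obtain x l where p: "p = (x, l)" by (cases p)
  have v': "v = (us @ [(x, l)]) @ ws"
    using Cons.prems(1) p by simp
  have l012: "l = 0 \<or> l = 1 \<or> l = 2"
    using lab v' by (auto simp: twin_labelling_def)
  have zero: "pick 1 ns = []" "pick 2 ns = []" if "\<forall>p\<in>set ns. snd p = 0" for ns :: "(nat \<times> nat) list"
    using that by (auto intro!: pick_eq_Nil)
  consider "l = 0" | "l = 1" | "l = 2" using l012 by blast
  then show ?case
  proof cases
    case 1
    have "x \<noteq> y" if sy: "s = Some (y, c)" for y c
    proof
      assume "x = y"
      obtain us' ns where us: "us = us' @ (y, c) # ns" "c \<noteq> 0" "\<forall>p\<in>set ns. snd p = 0"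
        using Cons.prems(3) sy by auto
      have "twin_labelling w m (us' @ (y, 0) # ns @ (y, c) # ws)"
        using lab us zero[OF us(3)] unfolding v' \<open>l = 0\<close> \<open>x = y\<close> twin_labelling_def
        by (auto split: if_splits)
      moreover have "(map snd (us' @ (y, 0) # ns @ (y, c) # ws), map snd v) \<in> lex less_than"
        using us(2) unfolding v' us(1) by (auto intro!: lex_less_thanI)
      ultimately show False
        using min by blast
    qed
    moreover have "canonical q s ws"
    proof (rule Cons.IH[OF v'])
      show "pick 1 (us @ [(x, l)]) = pick 2 (us @ [(x, l)]) @ q"
        using Cons.prems(2) 1 by simp
      show "s = None \<or> (\<exists>us' y c ns. s = Some (y, c) \<and> us @ [(x, l)] = us' @ (y, c) # ns \<and>
              c \<noteq> 0 \<and> (\<forall>p\<in>set ns. snd p = 0))"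
        using Cons.prems(3)
      proof
        assume "\<exists>us' y c ns. s = Some (y, c) \<and> us = us' @ (y, c) # ns \<and>
              c \<noteq> 0 \<and> (\<forall>p\<in>set ns. snd p = 0)"
        then obtain us' y c ns where "s = Some (y, c) \<and> us = us' @ (y, c) # ns \<and>
              c \<noteq> 0 \<and> (\<forall>p\<in>set ns. snd p = 0)" by blast
        then show ?thesis
          using 1 by (intro disjI2 exI[of _ us'] exI[of _ y] exI[of _ c] exI[of _ "ns @ [(x, l)]"]) auto
      qed simp
    qed
    ultimately show ?thesis
      using 1 p by auto
  next
    case 2
    have "x \<noteq> y" if sy: "s = Some (y, 2)" for y
    proof
      assume "x = y"
      obtain us' ns where us: "us = us' @ (y, 2) # ns" "\<forall>p\<in>set ns. snd p = 0"
        using Cons.prems(3) sy by auto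
      have "length (pick 2 v) = m"
        using lab by (auto simp: twin_labelling_def)
      then have "twin_labelling w m (us' @ (y, 1) # ns @ (y, 2) # ws)"
        using lab us zero[OF us(2)] unfolding v' \<open>l = 1\<close> \<open>x = y\<close> twin_labelling_def
        by (auto split: if_splits)
      moreover have "(map snd (us' @ (y, 1) # ns @ (y, 2) # ws), map snd v) \<in> lex less_than"
        unfolding v' us(1) by (auto intro!: lex_less_thanI)
      ultimately show False
        using min by blast
    qed
    moreover have "canonical (q @ [x]) (Some (x, 1)) ws"
    proof (rule Cons.IH[OF v'])
      show "Some (x, 1) = None \<or> (\<exists>us' y c ns. Some (x, 1) = Some (y, c) \<and>
          us @ [(x, l)] = us' @ (y, c) # ns \<and> c \<noteq> 0 \<and> (\<forall>p\<in>set ns. snd p = 0))"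
        using 2 by (intro disjI2 exI[of _ us] exI[of _ x] exI[of _ 1] exI[of _ "[]"]) simp
    qed (use Cons.prems(2) 2 in simp)
    ultimately show ?thesis
      using 2 p by auto
  next
    case 3
    have twins: "pick 1 v = pick 2 v" "map fst v = w" "snd ` set v \<subseteq> {0, 1, 2}"
        "length (pick 1 v) = m"
      using lab by (auto simp: twin_labelling_def)
    have "q \<noteq> []"
    proof
      assume "q = []"
      \<comment> \<open>With \<open>q\<close> empty the twins agree on \<open>us\<close>, hence also
        on the remainder, where their roles can be exchanged. The first changed label drops from 2
        to 1.\<close>
      define v1 where "v1 = us @ map (apsnd swap_label) ((x, l) # ws)"
      have bal: "pick 1 us = pick 2 us"
        using Cons.prems(2) \<open>q = []\<close> by simp
      have v'': "v = us @ (x, l) # ws"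
        using v' by simp
      have "pick 1 ((x, l) # ws) = pick 2 ((x, l) # ws)"
        using twins(1) bal unfolding v'' pick_simps(3) by simp
      then have "pick 1 v1 = pick 1 v" "pick 2 v1 = pick 2 v"
        unfolding v1_def v'' pick_simps(3) pick_swap_label by simp_all
      moreover have "map fst v1 = map fst v"
        unfolding v1_def v'' by simp
      moreover have "snd ` set v1 \<subseteq> {0, 1, 2}"
      proof -
        have "snd ` set us \<subseteq> {0, 1, 2}" "swap_label ` snd ` set ((x, l) # ws) \<subseteq> {0, 1, 2}"
          using twins(3) unfolding v'' by (auto simp: swap_label_def)
        then show ?thesis
          unfolding v1_def by (simp add: image_Un image_image)
      qed
      ultimately have "twin_labelling w m v1"
        using twins by (simp add: twin_labelling_def)
      moreover have "(map snd v1, map snd v) \<in> lex less_than"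
        using lex_less_thanI[of "map (swap_label \<circ> snd) ws" "map snd ws" 1 2 "map snd us"] 3
        unfolding v1_def v'' by (simp add: swap_label_def o_def)
      ultimately show False
        using min by blast
    qed
    then obtain z q' where q': "q = z # q'"
      by (cases q) auto
    \<comment> \<open>After the common prefix \<open>pick 2 us\<close>, the first twin continues
      with \<open>z\<close> and the second with \<open>x\<close>.\<close>
    have "x = z"
      using twins(1) Cons.prems(2) 3 unfolding v' q' by simp
    moreover have "canonical q' (Some (x, 2)) ws"
    proof (rule Cons.IH[OF v'])
      show "Some (x, 2) = None \<or> (\<exists>us' y c ns. Some (x, 2) = Some (y, c) \<and>
          us @ [(x, l)] = us' @ (y, c) # ns \<and> c \<noteq> 0 \<and> (\<forall>p\<in>set ns. snd p = 0))"
        using 3 by (intro disjI2 exI[of _ us] exI[of _ x] exI[of _ 2] exI[of _ "[]"]) simp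
    qed (use Cons.prems(2) 3 q' \<open>x = z\<close> in simp)
    ultimately show ?thesis
      using 3 p q' by auto
  qed
qed

text \<open>The twins are cut to length \<open>m\<close>; well-foundedness of \<open>lex\<close>
  then supplies a labelling with minimal label word.\<close>

lemma has_twins_imp_canonical_labelling:
  assumes "has_twins w m'" "m \<le> m'"
  shows "\<exists>v. twin_labelling w m v \<and> canonical [] None v"
proof -
  obtain v0 where v0: "twin_labelling w m v0"
    using has_twins_imp_labelling[OF assms(1)] twin_labelling_mono assms(2) by blast
  have "wf (inv_image (lex less_than) (map snd :: (nat \<times> nat) list \<Rightarrow> nat list))"
    by (intro wf_inv_image wf_lex wf_less_than)
  from wfE_min[OF this, of v0 "{v. twin_labelling w m v}"] v0
  obtain v where v: "twin_labelling w m v"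
    "\<And>v'. (map snd v', map snd v) \<in> lex less_than \<Longrightarrow> \<not> twin_labelling w m v'"
    by (auto simp: inv_image_def)
  have "canonical [] None v"
    by (rule minimal_imp_canonical[OF v(1), where us = "[]"]) (use v(2) in auto)
  then show ?thesis
    using v(1) by blast
qed

section \<open>Weighted count of canonical labellings\<close>

definition canonical_set :: "nat \<Rightarrow> nat \<Rightarrow> nat list \<Rightarrow> (nat \<times> nat) option \<Rightarrow> (nat \<times> nat) list set" where
  "canonical_set k n q s = {v. length v = n \<and> set v \<subseteq> {1..k} \<times> {0, 1, 2} \<and> canonical q s v}"

lemma finite_canonical_set [simp]: "finite (canonical_set k n q s)"
proof (rule finite_subset)
  show "canonical_set k n q s \<subseteq> {v. set v \<subseteq> {1..k} \<times> {0, 1, 2} \<and> length v = n}"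
    by (auto simp: canonical_set_def)
  show "finite {v. set v \<subseteq> {1..k} \<times> {0::nat, 1, 2} \<and> length v = n}"
    by (intro finite_lists_length_eq) auto
qed

lemma canonical_set_0: "canonical_set k 0 q s = {[]}"
  by (auto simp: canonical_set_def)

text \<open>The option holds the letter forbidden at the next position; \<open>None\<close> forbids
  nothing.\<close>

definition fresh :: "nat \<Rightarrow> nat option \<Rightarrow> nat set" where
  "fresh k s = {1..k} - set_option s"

text \<open>The label of the first letter fixes the next state. Label 2 leaves no choice of letter,
  so its branch contributes no factor of about \<open>k\<close>.\<close>

lemma canonical_set_Suc:
  "canonical_set k (Suc n) q s \<subseteq>
     (\<Union>x\<in>fresh k (map_option fst s). Cons (x, 0) ` canonical_set k n q s) \<union>
     (\<Union>x\<in>fresh k (if \<exists>y. s = Some (y, 2) then map_option fst s else None).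
        Cons (x, 1) ` canonical_set k n (q @ [x]) (Some (x, 1))) \<union>
     (if q = [] then {} else Cons (hd q, 2) ` canonical_set k n (tl q) (Some (hd q, 2)))"
  (is "_ \<subseteq> ?V0 \<union> ?V1 \<union> ?V2")
proof
  fix v assume "v \<in> canonical_set k (Suc n) q s"
  then obtain x l v' where v: "v = (x, l) # v'" "length v' = n" "x \<in> {1..k}" "l \<in> {0, 1, 2}"
      "set v' \<subseteq> {1..k} \<times> {0, 1, 2}" "canonical q s ((x, l) # v')"
    by (auto simp: canonical_set_def length_Suc_conv)
  then consider "l = 0" | "l = 1" | "l = 2" by blast
  then show "v \<in> ?V0 \<union> ?V1 \<union> ?V2"
  proof cases
    case 1
    then have "x \<in> fresh k (map_option fst s)" "v' \<in> canonical_set k n q s"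
      using v by (auto simp: fresh_def canonical_set_def)
    then show ?thesis
      using v(1) 1 by blast
  next
    case 2
    then have "x \<in> fresh k (if \<exists>y. s = Some (y, 2) then map_option fst s else None)"
      "v' \<in> canonical_set k n (q @ [x]) (Some (x, 1))"
      using v by (auto simp: fresh_def canonical_set_def)
    then show ?thesis
      using v(1) 2 by blast
  next
    case 3
    then have "q \<noteq> []" "x = hd q" "v' \<in> canonical_set k n (tl q) (Some (hd q, 2))"
      using v by (auto simp: canonical_set_def)
    then show ?thesis
      using v(1) 3 by simp
  qed
qed

text \<open>The weight depends only on how often each label occurs, so a bound on the total weight
  bounds the number of labellings with prescribed twin length.\<close>

definition weight :: "(nat \<Rightarrow> real) \<Rightarrow> (nat \<times> nat) list \<Rightarrow> real" where
  "weight c v = (\<Prod>p\<leftarrow>v. c (snd p))"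

lemma weight_Cons: "weight c (p # v) = c (snd p) * weight c v"
  by (simp add: weight_def)

lemma sum_weight_Cons:
  "sum (weight c) (Cons p ` V) = c (snd p) * sum (weight c) V"
  by (subst sum.reindex) (auto simp: weight_Cons sum_distrib_left)

lemma weight_nonneg: "(\<And>l. c l \<ge> 0) \<Longrightarrow> weight c v \<ge> 0"
  by (induction v) (auto simp: weight_def)

text \<open>A union bound: since \<open>f\<close> is nonnegative, overlaps only help.\<close>

lemma sum_UNION_le:
  assumes "finite X" "\<And>x. x \<in> X \<Longrightarrow> finite (V x)" "\<And>v. f v \<ge> (0::real)"
    "\<And>x. x \<in> X \<Longrightarrow> sum f (V x) \<le> B" "real (card X) \<le> N" "B \<ge> 0"
  shows "sum f (\<Union>x\<in>X. V x) \<le> N * B"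
proof -
  have "sum f (\<Union>x\<in>Y. V x) \<le> (\<Sum>x\<in>Y. sum f (V x))" if "finite Y" "Y \<subseteq> X" for Y
    using that
  proof (induction Y rule: finite_induct)
    case (insert x Y)
    have "finite (V x)" "finite (\<Union>y\<in>Y. V y)"
      using insert.hyps insert.prems assms(2) by auto
    then have "sum f (V x \<union> (\<Union>y\<in>Y. V y)) \<le> sum f (V x) + sum f (\<Union>y\<in>Y. V y)"
      using assms(3) by (simp add: sum_Un sum_nonneg)
    then show ?case
      using insert by simp
  qed simp
  then have "sum f (\<Union>x\<in>X. V x) \<le> (\<Sum>x\<in>X. sum f (V x))"
    using assms(1) by blast
  also have "\<dots> \<le> real (card X) * B"
    by (rule sum_bounded_above) (use assms in auto)
  also have "\<dots> \<le> N * B"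
    using assms by (intro mult_right_mono) auto
  finally show ?thesis .
qed

text \<open>The numbers \<open>1/r\<close> and \<open>1\<close> form a positive eigenvector of the transfer matrix on
  the states "last used label is 1" and "last used label is 2".\<close>

definition potential :: "real \<Rightarrow> nat \<Rightarrow> (nat \<times> nat) option \<Rightarrow> real" where
  "potential r n s = (case s of None \<Rightarrow> real (n + 1) / r | Some (y, l) \<Rightarrow> if l = 2 then 1 else 1 / r)"

text \<open>Reading one letter does not push the weighted count above \<open>potential\<close>. The
  hypotheses \<open>step1\<close> and \<open>step2\<close> are the one-step inequalities for last
  used label 1 and 2, multiplied by \<open>r\<close>.\<close>

lemma weight_canonical_set_le:
  assumes c: "\<And>l. c l \<ge> 0" and r: "0 < r" "r \<le> 1" and k: "k \<ge> 1"
    and c0: "real k * c 0 \<le> 1"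
    and step1: "(real k - 1) * c 0 + real k * c 1 + c 2 * r \<le> 1"
    and step2: "(real k - 1) * c 0 * r + (real k - 1) * c 1 + c 2 * r \<le> r"
    and s: "set_option (map_option fst s) \<subseteq> {1..k}" "s = None \<Longrightarrow> q = []"
    and q: "set q \<subseteq> {1..k}"
  shows "sum (weight c) (canonical_set k n q s) \<le> potential r n s"
  using s q
proof (induction n arbitrary: q s)
  case 0
  then show ?case
    using r by (auto simp: canonical_set_0 weight_def potential_def split: option.splits)
next
  case (Suc n)
  define b0 where "b0 = real (card (fresh k (map_option fst s)))"
  define s1 where "s1 = (if \<exists>y. s = Some (y, 2) then map_option fst s else None)"
  define b1 where "b1 = real (card (fresh k s1))"
  define V0 where "V0 = (\<Union>x\<in>fresh k (map_option fst s). Cons (x, 0::nat) ` canonical_set k n q s)"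
  define V1 where "V1 = (\<Union>x\<in>fresh k s1. Cons (x, 1::nat) ` canonical_set k n (q @ [x]) (Some (x, 1)))"
  define V2 where "V2 = (if q = [] then {} else Cons (hd q, 2::nat) ` canonical_set k n (tl q) (Some (hd q, 2)))"
  have fin: "finite (fresh k t)" for t
    by (simp add: fresh_def)
  have finV: "finite V0" "finite V1" "finite V2"
    using fin by (auto simp: V0_def V1_def V2_def)
  note nn = weight_nonneg[of c, OF c]
  have potential_nn: "potential r n t \<ge> 0" for t
    using r by (auto simp: potential_def split: option.splits)
  have sub: "canonical_set k (Suc n) q s \<subseteq> V0 \<union> V1 \<union> V2"
    using canonical_set_Suc unfolding V0_def V1_def V2_def s1_def .
  have 0: "sum (weight c) V0 \<le> b0 * (c 0 * potential r n s)"
    unfolding V0_def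
    by (rule sum_UNION_le[OF fin _ nn])
      (use Suc c potential_nn in \<open>auto simp: sum_weight_Cons b0_def intro!: mult_left_mono\<close>)
  have 1: "sum (weight c) V1 \<le> b1 * (c 1 * (1 / r))"
    unfolding V1_def
  proof (rule sum_UNION_le[OF fin _ nn])
    fix x assume x: "x \<in> fresh k s1"
    have "sum (weight c) (canonical_set k n (q @ [x]) (Some (x, 1))) \<le> potential r n (Some (x, 1))"
      by (rule Suc.IH) (use Suc.prems x in \<open>auto simp: fresh_def\<close>)
    then have "c 1 * sum (weight c) (canonical_set k n (q @ [x]) (Some (x, 1))) \<le> c 1 * (1 / r)"
      using c by (intro mult_left_mono) (auto simp: potential_def)
    then show "sum (weight c) (Cons (x, 1::nat) ` canonical_set k n (q @ [x]) (Some (x, 1))) \<le> c 1 * (1 / r)"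
      by (simp add: sum_weight_Cons)
  qed (use c r in \<open>auto simp: b1_def\<close>)
  have 2: "sum (weight c) V2 \<le> (if q = [] then 0 else c 2)"
  proof (cases "q = []")
    case False
    have "sum (weight c) (canonical_set k n (tl q) (Some (hd q, 2))) \<le> potential r n (Some (hd q, 2))"
    proof (rule Suc.IH)
      show "set_option (map_option fst (Some (hd q, 2::nat))) \<subseteq> {1..k}"
        using Suc.prems(3) hd_in_set[OF False] by auto
      show "set (tl q) \<subseteq> {1..k}"
        using Suc.prems(3) list.set_sel(2)[OF False] by blast
    qed simp
    then have "c 2 * sum (weight c) (canonical_set k n (tl q) (Some (hd q, 2))) \<le> c 2 * 1"
      using c by (intro mult_left_mono) (auto simp: potential_def)
    then show ?thesis
      using False by (simp add: V2_def sum_weight_Cons)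
  qed (simp add: V2_def)
  have "sum (weight c) (canonical_set k (Suc n) q s) \<le> sum (weight c) (V0 \<union> V1 \<union> V2)"
    using sub finV nn by (intro sum_mono2) auto
  also have "\<dots> \<le> sum (weight c) (V0 \<union> V1) + sum (weight c) V2"
    using finV nn by (subst sum.union_inter [symmetric]) (auto intro!: sum_nonneg)
  also have "\<dots> \<le> sum (weight c) V0 + sum (weight c) V1 + sum (weight c) V2"
    using finV nn sum.union_inter[of V0 V1 "weight c"] sum_nonneg[of "V0 \<inter> V1" "weight c"] by auto
  also have "\<dots> \<le> b0 * (c 0 * potential r n s) + b1 * (c 1 * (1 / r)) + (if q = [] then 0 else c 2)"
    using 0 1 2 by linarith
  also have "\<dots> \<le> potential r (Suc n) s"
  proof (cases s)
    case None
    \<comment> \<open>In the start state nothing is forbidden and label 2 is impossible. Staying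
      there costs a factor \<open>k * c 0\<close>, at most 1, and leaving it through label 1 adds at
      most \<open>1 / r\<close>; hence the linear growth in \<open>n\<close>.\<close>
    have b: "b0 = real k" "b1 = real k" "q = []"
      using None Suc.prems by (auto simp: b0_def b1_def s1_def fresh_def)
    have "real k * c 1 \<le> 1"
      using step1 c[of 0] c[of 2] r k mult_nonneg_nonneg[of "real k - 1" "c 0"] mult_nonneg_nonneg[of "c 2" r]
      by linarith
    then have "real k * (c 1 * (1 / r)) \<le> 1 / r"
      using r by (simp add: divide_simps)
    moreover have "real k * (c 0 * potential r n s) \<le> potential r n s"
      using mult_right_mono[OF c0 potential_nn[of s]] by (simp add: mult.assoc)
    moreover have "potential r (Suc n) s = potential r n s + 1 / r"
      using None by (simp add: potential_def add_divide_distrib)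
    ultimately show ?thesis
      using b by simp
  next
    case (Some a)
    obtain y l where a: "a = (y, l)" by (cases a)
    have y: "y \<in> {1..k}"
      using Suc.prems Some a by simp
    have b0: "b0 = real k - 1"
      using Some a y k by (simp add: b0_def fresh_def of_nat_diff)
    have q2: "(if q = [] then 0 else c 2) \<le> c 2"
      using c by simp
    show ?thesis
    proof (cases "l = 2")
      case True
      have b1: "b1 = real k - 1"
        using True Some a y k by (simp add: b1_def s1_def fresh_def of_nat_diff)
      have "(real k - 1) * (c 0 * 1) + (real k - 1) * (c 1 * (1 / r)) + c 2 \<le> 1"
        using step2 r by (simp add: field_simps)
      then show ?thesis
        using q2 b0 b1 True Some a by (simp add: potential_def)
    next
      case False
      have b1: "b1 = real k"
        using False Some a by (simp add: b1_def s1_def fresh_def)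
      have "(real k - 1) * (c 0 * (1 / r)) + real k * (c 1 * (1 / r)) + c 2 \<le> 1 / r"
        using divide_right_mono[OF step1, of r] r by (simp add: add_divide_distrib)
      then show ?thesis
        using q2 b0 b1 False Some a by (simp add: potential_def)
    qed
  qed
  finally show ?case .
qed

section \<open>From the count to a word without long twins\<close>

lemma weight_eq:
  assumes "snd ` set v \<subseteq> {0, 1, 2}"
  shows "weight c v = c 0 ^ length (pick 0 v) * c 1 ^ length (pick 1 v) * c 2 ^ length (pick 2 v)"
  using assms by (induction v) (auto simp: weight_def)

lemma length_pick_sum:
  assumes "snd ` set v \<subseteq> {0, 1, 2}"
  shows "length (pick 0 v) + length (pick 1 v) + length (pick 2 v) = length v"
  using assms by (induction v) auto

lemma words_finite [simp]: "finite (words k n)"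
  using finite_lists_length_eq[of "{1..k}" n] by (simp add: words_def conj_commute)

lemma card_words: "card (words k n) = k ^ n"
  using card_lists_length_eq[of "{1..k}" n] by (simp add: words_def conj_commute)

text \<open>One good word suffices for the minimum. For \<open>LT w\<close> to be an attained
  maximum, the set of twin lengths must be bounded and contain 0.\<close>

lemma LTkn_less:
  assumes "w \<in> words k n" "\<And>m'. m \<le> m' \<Longrightarrow> \<not> has_twins w m'"
  shows "LTkn k n < m"
proof -
  have less: "j < m" if "has_twins w j" for j
    using assms(2) that not_le by blast
  then have fin: "finite {j. has_twins w j}"
    by (auto intro!: finite_subset[OF _ finite_lessThan])
  have "has_twins w 0"
    unfolding has_twins_def by (intro exI[of _ "{}"] conjI) simp_all
  then have "has_twins w (LT w)"
    unfolding LT_def using Max_in[OF fin] by blast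
  then have "LT w < m"
    by (rule less)
  moreover have "LTkn k n \<le> LT w"
    unfolding LTkn_def by (intro Min_le finite_imageI words_finite imageI assms(1))
  ultimately show ?thesis by simp
qed

text \<open>First moment argument: each word with twins of length at least \<open>m\<close>
  underlies some labelling in \<open>T\<close>. All these labellings have the same weight
  \<open>W\<close>, so \<open>few\<close> leaves fewer than \<open>k ^ n\<close> of them and some
  word is missed.\<close>

lemma LTkn_less_if_weight:
  fixes c :: "nat \<Rightarrow> real" and r :: real
  assumes c: "\<And>l. c l \<ge> 0" and r: "0 < r" "r \<le> 1" and k: "k \<ge> 1"
    and c0: "real k * c 0 \<le> 1"
    and step1: "(real k - 1) * c 0 + real k * c 1 + c 2 * r \<le> 1"
    and step2: "(real k - 1) * c 0 * r + (real k - 1) * c 1 + c 2 * r \<le> r"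
    and mn: "2 * m \<le> n" and c0pos: "c 0 > 0"
    and few: "real (n + 1) / r < real k ^ n * (c 0 ^ (n - 2 * m) * (c 1 * c 2) ^ m)"
  shows "LTkn k n < m"
proof -
  define T where "T = {v \<in> canonical_set k n [] None. pick 1 v = pick 2 v \<and> length (pick 1 v) = m}"
  define B where "B = {w \<in> words k n. \<exists>m'\<ge>m. has_twins w m'}"
  define W where "W = c 0 ^ (n - 2 * m) * (c 1 * c 2) ^ m"
  have "B \<subseteq> map fst ` T"
  proof
    fix w assume w: "w \<in> B"
    then obtain m' where "m \<le> m'" "has_twins w m'"
      by (auto simp: B_def)
    then obtain v where v: "twin_labelling w m v" "canonical [] None v"
      using has_twins_imp_canonical_labelling by blast
    have "map fst v = w" and w': "length w = n" "set w \<subseteq> {1..k}"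
      using v w by (simp_all add: B_def words_def twin_labelling_def)
    moreover have "length v = n"
      using \<open>map fst v = w\<close> w'(1) by auto
    moreover have "set v \<subseteq> {1..k} \<times> {0, 1, 2}"
    proof
      fix p assume "p \<in> set v"
      then have "fst p \<in> set w" "snd p \<in> {0, 1, 2}"
        using v(1) by (auto simp: twin_labelling_def)
      then show "p \<in> {1..k} \<times> {0, 1, 2}"
        using w'(2) by (auto simp: mem_Times_iff)
    qed
    ultimately have "v \<in> T"
      using v by (auto simp: T_def canonical_set_def twin_labelling_def)
    then show "w \<in> map fst ` T"
      using v by (auto simp: twin_labelling_def)
  qed
  moreover have finT: "finite T"
    by (simp add: T_def)
  ultimately have BT: "card B \<le> card T"
    by (meson card_image_le card_mono finite_imageI le_trans)
  have wt: "weight c v = W" if "v \<in> T" for v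
  proof -
    have "snd ` set v \<subseteq> {0, 1, 2}" and len: "length v = n"
      using that by (auto simp: T_def canonical_set_def)
    then have "length (pick 0 v) = n - 2 * m"
      using length_pick_sum[of v] that len by (auto simp: T_def)
    then show ?thesis
      using weight_eq[of v c] that \<open>snd ` set v \<subseteq> _\<close>
      by (auto simp: T_def W_def power_mult_distrib mult.assoc)
  qed
  have "real (card T) * W = sum (weight c) T"
    using wt by simp
  also have "\<dots> \<le> sum (weight c) (canonical_set k n [] None)"
    by (rule sum_mono2) (auto simp: T_def weight_nonneg c)
  also have "\<dots> \<le> real (n + 1) / r"
    using weight_canonical_set_le[OF c r k c0 step1 step2, of None "[]" n] by (simp add: potential_def)
  also have "\<dots> < real k ^ n * W"
    using few by (simp add: W_def)
  finally have "real (card T) * W < real k ^ n * W" .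
  moreover have "W \<ge> 0"
    unfolding W_def by (intro mult_nonneg_nonneg zero_le_power c)
  ultimately have "real (card T) < real k ^ n"
    by (rule mult_right_less_imp_less)
  then have "card T < k ^ n"
    by (metis of_nat_less_iff of_nat_power)
  then have "card B < card (words k n)"
    using BT unfolding card_words by linarith
  moreover have "finite B"
    by (simp add: B_def)
  ultimately have "\<not> words k n \<subseteq> B"
    using card_mono not_le by blast
  then obtain w where w: "w \<in> words k n" "w \<notin> B"
    by blast
  show ?thesis
    by (rule LTkn_less[OF w(1)]) (use w in \<open>simp add: B_def\<close>)
qed

lemma has_twins_length: "has_twins w m \<Longrightarrow> 2 * m \<le> length w"
proof -
  assume "has_twins w m"
  then obtain I J where IJ: "I \<subseteq> {..<length w}" "J \<subseteq> {..<length w}" "I \<inter> J = {}"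
    "card I = m" "card J = m"
    by (auto simp: has_twins_def)
  then have "2 * m = card (I \<union> J)"
    by (subst card_Un_disjoint) (auto intro: finite_subset)
  also have "\<dots> \<le> card {..<length w}"
    using IJ by (intro card_mono) auto
  finally show ?thesis by simp
qed

text \<open>Disjoint twins together occupy at most \<open>n\<close> positions; this settles the
  endpoint \<open>a = 1/2\<close>.\<close>

lemma LTkn_le_half:
  assumes "k \<ge> 1"
  shows "2 * LTkn k n \<le> n"
proof -
  have "LTkn k n < n div 2 + 1"
  proof (rule LTkn_less)
    show "replicate n 1 \<in> words k n"
      using assms by (auto simp: words_def)
  next
    fix m' assume "n div 2 + 1 \<le> m'"
    then show "\<not> has_twins (replicate n 1) m'"
      using has_twins_length[of "replicate n 1" m'] by auto
  qed
  then show ?thesis by simp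
qed

section \<open>The bound for a fixed density\<close>

text \<open>An exponential gain absorbs the linear factor from the start state and the bounded
  rounding loss \<open>D\<close>.\<close>

lemma eventually_linear_less_exp:
  assumes "E > 0" "r > 0"
  shows "\<forall>\<^sub>F n in sequentially. real (n + 1) / r < exp (real n * E - D)"
  using assms by real_asymp

lemma eventually_LTkn_le_strict:
  assumes k: "k \<ge> 2" and a: "1 / real k \<le> a" "a < 1/2" and neg: "twin_expr k a < 0"
  shows "\<forall>\<^sub>F n in sequentially. real (LTkn k n) \<le> a * real n"
proof -
  \<comment> \<open>For weights \<open>g / k\<close> and \<open>g\<close> of the labels 1 and 2,
    equality in both \<open>step1\<close> and \<open>step2\<close> forces \<open>r * r = x\<close>
    and \<open>g * (1 + r) = 2 * a\<close>.\<close>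
  define x where "x = 1 - 1 / real k"
  define r where "r = sqrt x"
  define g where "g = 2 * a / (1 + r)"
  \<comment> \<open>The weights are proportioned so that the transfer matrix has eigenvalue 1 and a typical canonical
    labelling uses a fraction \<open>2 * a\<close> of the positions.\<close>
  define c :: "nat \<Rightarrow> real" where
    "c l = (if l = 0 then (1 - 2 * a) / (real k - 1) else if l = 1 then g / real k else g)" for l
  have x: "0 < x" "x \<le> 1" "x * real k = real k - 1"
    using k by (auto simp: x_def field_simps)
  have r: "0 < r" "r \<le> 1" "r * r = x"
    using x by (auto simp: r_def)
  have a0: "a > 0"
  proof -
    have "1 / real k > 0"
      using k by simp
    then show ?thesis
      using a(1) by linarith
  qed
  have g: "g > 0" "g * (1 + r) = 2 * a"
    using a0 r by (auto simp: g_def)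
  define A where "A = real k * c 0"
  define G where "G = real k * g ^ 2"
  have c0: "(real k - 1) * c 0 = 1 - 2 * a"
    using k by (simp add: c_def)
  have A: "A = (1 - 2 * a) / x"
    using x k by (simp add: A_def c_def flip: x(3))
  \<comment> \<open>The lower bound \<open>1 / real k\<close> on \<open>a\<close> gives
    \<open>A \<le> 1\<close>, the condition on the start state.\<close>
  have "1 - 2 * a \<le> x"
    using a a0 unfolding x_def by linarith
  then have A0: "A > 0" and A1: "A \<le> 1"
    using a x by (simp_all add: A)
  have G0: "G > 0"
    using g k by (simp add: G_def)
  define E where "E = (1 - 2 * a) * ln A + a * ln G"
  have "E = - twin_expr k a"
  proof -
    have "ln A = ln (1 - 2 * a) - ln x"
      using a x by (simp add: A ln_div)
    moreover have "ln G = ln (real k) + 2 * (ln 2 + ln a - ln (1 + r))"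
      using k g a0 r by (simp add: G_def g_def ln_mult ln_div ln_realpow)
    ultimately show ?thesis
      using a a0 k r
      by (simp add: E_def twin_expr_def ln_div ln_mult ln_realpow flip: x_def r_def)
        (simp add: algebra_simps)
  qed
  then have E: "E > 0"
    using neg by simp
  \<comment> \<open>Bounds the change of the exponent when \<open>a * n\<close> is rounded up to
    \<open>m\<close>.\<close>
  define D where "D = \<bar>ln G - 2 * ln A\<bar>"
  \<comment> \<open>Since \<open>m \<le> a * n + 1\<close>, this size of \<open>n\<close> ensures
    \<open>2 * m \<le> n\<close>.\<close>
  have "\<forall>\<^sub>F n in sequentially. real n \<ge> 2 / (1 - 2 * a)"
    by real_asymp
  moreover have "\<forall>\<^sub>F n in sequentially. real (n + 1) / r < exp (real n * E - D)"
    using E r(1) by (rule eventually_linear_less_exp)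
  ultimately show ?thesis
  proof eventually_elim
    case (elim n)
    \<comment> \<open>The \<open>+ 1\<close> matches the strict bound \<open>LTkn k n < m\<close>,
      which then gives the floor itself.\<close>
    define m where "m = nat \<lfloor>a * real n\<rfloor> + 1"
    define t where "t = real m - a * real n"
    have an: "a * real n \<ge> 0"
      using a0 by simp
    have t: "0 \<le> t" "t \<le> 1"
      using an unfolding t_def m_def by linarith+
    have mn: "2 * m \<le> n"
    proof -
      have "2 \<le> (1 - 2 * a) * real n"
        using elim(1) a by (simp add: field_simps)
      then have "2 * real m \<le> real n"
        using t unfolding t_def by (simp add: algebra_simps)
      then show ?thesis by linarith
    qed
    have "LTkn k n < m"
    proof (rule LTkn_less_if_weight[where c = c and r = r])
      show "c l \<ge> 0" for l
        using a k g by (simp add: c_def)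
      show "real k * c 0 \<le> 1"
        using A1 by (simp add: A_def)
      show "(real k - 1) * c 0 + real k * c 1 + c 2 * r \<le> 1"
        using c0 g k by (simp add: c_def algebra_simps)
      have "(real k - 1) * c 1 = x * g"
        using x k by (simp add: c_def flip: x(3))
      moreover have "(1 - 2 * a) * r + x * g + g * r = r"
      proof -
        have "(1 - 2 * a) * r + x * g + g * r = (1 - 2 * a) * r + (g * (1 + r)) * r"
          by (simp add: algebra_simps flip: r(3))
        also have "\<dots> = r"
          unfolding g(2) by (simp add: algebra_simps)
        finally show ?thesis .
      qed
      ultimately show "(real k - 1) * c 0 * r + (real k - 1) * c 1 + c 2 * r \<le> r"
        using c0 by (simp add: c_def)
      show "c 0 > 0"
        using a k by (simp add: c_def)
      have "real k ^ n = real k ^ (n - 2 * m) * (real k ^ 2) ^ m"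
        using mn by (simp flip: power_mult power_add)
      then have "real k ^ n * (c 0 ^ (n - 2 * m) * (c 1 * c 2) ^ m) =
          (real k * c 0) ^ (n - 2 * m) * (real k ^ 2 * (c 1 * c 2)) ^ m"
        by (simp add: power_mult_distrib)
      also have "real k ^ 2 * (c 1 * c 2) = G"
        using k by (simp add: c_def G_def power2_eq_square)
      also have "(real k * c 0) ^ (n - 2 * m) * G ^ m = exp (real (n - 2 * m) * ln A + real m * ln G)"
        using A0 G0 by (simp add: exp_add exp_of_nat_mult flip: A_def)
      also have "real (n - 2 * m) * ln A + real m * ln G = real n * E + t * (ln G - 2 * ln A)"
        using mn by (simp add: of_nat_diff E_def t_def algebra_simps)
      finally have eq: "real k ^ n * (c 0 ^ (n - 2 * m) * (c 1 * c 2) ^ m) =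
        exp (real n * E + t * (ln G - 2 * ln A))" .
      have "\<bar>t * (ln G - 2 * ln A)\<bar> \<le> D"
        using t mult_right_mono[of t 1 D] by (simp add: D_def abs_mult)
      then have "exp (real n * E - D) \<le> exp (real n * E + t * (ln G - 2 * ln A))"
        by simp
      then show "real (n + 1) / r < real k ^ n * (c 0 ^ (n - 2 * m) * (c 1 * c 2) ^ m)"
        using elim(2) eq by linarith
    qed (use r k mn in auto)
    then have "LTkn k n \<le> nat \<lfloor>a * real n\<rfloor>"
      by (simp add: m_def)
    then show "real (LTkn k n) \<le> a * real n"
      using an by linarith
  qed
qed

lemma eventually_LTkn_le:
  assumes k: "k \<ge> 2" and a: "1 / real k \<le> a" "a \<le> 1/2" and neg: "twin_expr k a < 0"
  shows "\<forall>\<^sub>F n in sequentially. real (LTkn k n) \<le> a * real n"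
proof (cases "a = 1/2")
  case True
  have "real (LTkn k n) \<le> a * real n" for n
    using LTkn_le_half[of k n] k unfolding True by simp
  then show ?thesis by simp
next
  case False
  then show ?thesis
    using eventually_LTkn_le_strict[OF k a(1) _ neg] a(2) by simp
qed

section \<open>Numerical cases \<open>k = 4\<close> and \<open>k = 5\<close>\<close>

text \<open>The value lies within \<open>10 ^ -3\<close> of zero, so each logarithm needs a sharp
  rational bound. Splitting off powers of 2 brings the large argument near 1, where the series
  behind \<open>ln_approx_bounds\<close> converges fast.\<close>

lemma twin_expr_4: "twin_expr 4 0.4932 < 0"
proof -
  have 1: "ln (2::real) \<le> 4615 / 6658"
    using ln_approx_bounds[of 2 3] by (simp add: eval_nat_numeral)
  have 2: "ln (625 / 544 :: real) \<le> 0.1389"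
    using ln_approx_bounds[of "625/544" 1] by (simp add: eval_nat_numeral)
  have 3: "ln (1250 / 1233 :: real) \<le> 0.013695"
    using ln_approx_bounds[of "1250/1233" 1] by (simp add: eval_nat_numeral)
  have 4: "ln (10717 / 10000 :: real) \<ge> 0.06924"
    using ln_approx_bounds[of "10717/10000" 2] by (simp add: eval_nat_numeral)
  have 5: "ln (4 / 3 :: real) \<ge> 0.287"
    using ln_approx_bounds[of "4/3" 2] by (simp add: eval_nat_numeral)
  have "sqrt (3 / 4) \<le> (0.8661 :: real)"
    by (rule real_le_lsqrt) (simp_all add: power2_eq_square)
  then have "ln (10717 / 10000) \<le> ln (2 / (1 + sqrt (3 / 4)) :: real)"
    by (subst ln_le_cancel_iff) (auto simp: field_simps add_pos_nonneg)
  moreover have "ln (1250 / 17 :: real) = 6 * ln 2 + ln (625 / 544)"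
    using ln_mult[of "2 ^ 6" "625 / 544 :: real"] ln_realpow[of 2 6] by simp
  moreover have "ln (0.4932\<^sup>2 * 4 :: real) = - 2 * ln (1250 / 1233)"
    using ln_realpow[of "1233 / 1250" 2] by (simp add: ln_div power2_eq_square)
  moreover have "ln (3 / 4 :: real) = - ln (4 / 3)"
    by (simp add: ln_div)
  ultimately show ?thesis
    using 1 2 3 4 5 by (simp add: twin_expr_def add_divide_distrib)
qed

lemma twin_expr_5: "twin_expr 5 0.48 < 0"
proof -
  have 1: "ln (2::real) \<le> 4615 / 6658"
    using ln_approx_bounds[of 2 3] by (simp add: eval_nat_numeral)
  have 2: "ln (5 / 4 :: real) \<le> 0.22315"
    using ln_approx_bounds[of "5/4" 2] by (simp add: eval_nat_numeral)
  have 3: "ln (144 / 125 :: real) \<ge> 0.141498"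
    using ln_approx_bounds[of "144/125" 2] by (simp add: eval_nat_numeral)
  have 4: "ln (10557 / 10000 :: real) \<ge> 0.054202"
    using ln_approx_bounds[of "10557/10000" 2] by (simp add: eval_nat_numeral)
  have "sqrt (4 / 5) \<le> (0.89446 :: real)"
    by (rule real_le_lsqrt) (simp_all add: power2_eq_square)
  then have "ln (10557 / 10000) \<le> ln (2 / (1 + sqrt (4 / 5)) :: real)"
    by (subst ln_le_cancel_iff) (auto simp: field_simps add_pos_nonneg)
  moreover have "ln (25 :: real) = 4 * ln 2 + 2 * ln (5 / 4)"
    using ln_mult[of "2 ^ 4" "(5 / 4) ^ 2 :: real"] ln_realpow[of 2 4] ln_realpow[of "5 / 4" 2]
    \<comment> \<open>Together with \<open>ln (4 / 5)\<close>, the logarithm of \<open>5 / 4\<close>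
      has net coefficient \<open>0.04\<close>, so an upper bound on it suffices.\<close>
    by (simp add: power2_eq_square)
  moreover have "ln (4 / 5 :: real) = - ln (5 / 4)"
    by (simp add: ln_div)
  ultimately show ?thesis
    using 1 2 3 4 by (simp add: twin_expr_def power2_eq_square add_divide_distrib)
qed

section \<open>Asymptotics for large alphabets\<close>

text \<open>This is \<open>z \<le> sinh z\<close> at \<open>z = ln u\<close>.\<close>

lemma ln_le_half_diff_inverse:
  assumes "u \<ge> (1::real)"
  shows "ln u \<le> (u - 1 / u) / 2"
  using real_le_x_sinh[of "ln u"] assms by (simp add: inverse_eq_divide)

text \<open>The bound is exact to second order at 0; its quadratic term supplies the
  \<open>e\<^sup>2\<close> in the coefficient of \<open>1 / k\<close>.\<close>

lemma entropy_term_le: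
  assumes "0 \<le> y" "y < (1::real)"
  shows "(1 - y) * ln (1 / (1 - y)) \<le> y - y\<^sup>2 / 2"
proof -
  have "(1 - y) * ln (1 / (1 - y)) \<le> (1 - y) * ((1 / (1 - y) - (1 - y)) / 2)"
    using ln_le_half_diff_inverse[of "1 / (1 - y)"] assms
    by (intro mult_left_mono) auto
  also have "\<dots> = y - y\<^sup>2 / 2"
    using assms by (simp add: field_simps power2_eq_square)
  finally show ?thesis .
qed

text \<open>The right side is the tangent of the convex function \<open>x * ln x\<close> at
  \<open>x = exp 1\<close>, the limit of \<open>\<beta>\<close> below.\<close>

lemma x_ln_x_ge_tangent:
  assumes "x > (0::real)"
  shows "x * ln x \<ge> 2 * x - exp 1"
proof -
  have "ln (exp 1 / x) \<le> exp 1 / x - 1"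
    using assms by (intro ln_le_minus_one) simp
  then have "x * (1 - ln x) \<le> x * (exp 1 / x - 1)"
    using assms by (intro mult_left_mono) (simp_all add: ln_div)
  then show ?thesis
    using assms by (simp add: algebra_simps)
qed

text \<open>Here \<open>s\<close> is \<open>1 / sqrt k\<close> and the density is expanded in powers
  of \<open>s\<close>. The choice of \<open>b\<close> cancels the terms of order
  \<open>s\<^sup>2\<close> in the upper bound; \<open>c\<close> is chosen so that order
  \<open>s ^ 3\<close> leaves the negative coefficient \<open>- c\<close>.\<close>

lemma twin_expr_neg_large:
  fixes k :: nat and s :: real
  defines "e \<equiv> exp 1 :: real"
  defines "b \<equiv> - (e\<^sup>2 + 1 / 2)"
  defines "c \<equiv> 4 * e * (e\<^sup>2 + 1/2) + 2 * e + 1"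
  assumes s: "0 < s" "s \<le> 1 / 1000" "s\<^sup>2 = 1 / real k"
  defines "\<beta> \<equiv> e + b * s + c * s\<^sup>2"
  shows "twin_expr k (s * \<beta>) < 0" "1 / real k \<le> s * \<beta>" "s * \<beta> < 1 / 2"
proof -
  have e: "1 \<le> e" "e \<le> 3" "2 \<le> e"
    using exp_le exp_ge_add_one_self[of "1::real"] by (auto simp: e_def)
  have e2: "e\<^sup>2 \<le> 9"
    using power_mono[of e 3 2] e by simp
  have b: "b \<le> 0" "b \<ge> - 10"
    using e2 zero_le_power2[of e] unfolding b_def by linarith+
  have c: "c > 0" "c \<le> 4 * 3 * 10 + 7"
  proof -
    have "e * (e\<^sup>2 + 1/2) \<le> 3 * 10"
      using e e2 by (intro mult_mono) auto
    then show "c \<le> 4 * 3 * 10 + 7"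
      using e by (simp add: c_def)
    show "c > 0" using e by (simp add: c_def add_nonneg_pos)
  qed
  have s2: "0 \<le> s\<^sup>2" "s\<^sup>2 \<le> s * (1/1000)"
    using mult_left_mono[of s "1 / 1000" s] s by (simp_all only: power2_eq_square) auto
  have bs: "b * s \<le> 0" "b * s \<ge> -10 * s"
    using b s mult_right_mono[of "-10" b s] by (auto simp: mult_nonpos_nonneg)
  have cs: "0 \<le> c * s\<^sup>2" "c * s\<^sup>2 \<le> 127 * s\<^sup>2"
    using c s2 by (auto intro: mult_right_mono)
  \<comment> \<open>With \<open>s \<le> 1 / 1000\<close> both corrections to \<open>e\<close> are
    tiny, so crude bounds do.\<close>
  have \<beta>: "1 \<le> \<beta>" "\<beta> \<le> 4"
    using bs cs s s2 e by (auto simp: \<beta>_def)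
  have "s * \<beta> \<le> (1/1000) * 4"
    using s \<beta> by (intro mult_mono) auto
  then show half: "s * \<beta> < 1 / 2" by simp
  show "1 / real k \<le> s * \<beta>"
    using s \<beta> mult_left_mono[of s \<beta> s] unfolding s(3)[symmetric] power2_eq_square by simp
  define a where "a = s * \<beta>"
  have a: "0 < a" "a < 1/2"
    using s \<beta> half by (auto simp: a_def)
  \<comment> \<open>For \<open>k = 0\<close> the quotient \<open>1 / real k\<close> would be 0,
    contradicting \<open>s > 0\<close>.\<close>
  have k: "real k > 0"
    using s by (metis less_divide_eq_1_pos of_nat_0_less_iff of_nat_0 div_by_0 gr0I power_eq_0_iff less_irrefl)
  have t1: "(1 - 2 * a) * ln (1 / (1 - 2 * a)) \<le> 2 * a - 2 * a\<^sup>2"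
    using entropy_term_le[of "2 * a"] a by (simp add: power2_eq_square)
  have "a\<^sup>2 * real k = \<beta>\<^sup>2"
    using s(3) k by (simp add: a_def power_mult_distrib)
  then have "a * ln (a\<^sup>2 * real k) = 2 * s * (\<beta> * ln \<beta>)"
    using \<beta> by (simp add: a_def ln_realpow)
  then have t2: "a * ln (a\<^sup>2 * real k) \<ge> 2 * s * (2 * \<beta> - e)"
    using x_ln_x_ge_tangent[of \<beta>] \<beta> s by (simp add: e_def)
  \<comment> \<open>Replacing this term by 0 costs only order \<open>s ^ 3\<close>, which affects
    just the constant in the error term.\<close>
  have t3: "2 * a * ln (2 / (1 + sqrt (1 - 1 / real k))) \<ge> 0"
  proof -
    define q where "q = sqrt (1 - 1 / real k)"
    have k01: "0 \<le> 1 - 1 / real k" "1 - 1 / real k \<le> 1"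
      using s s2 k by auto
    have "0 \<le> q"
      unfolding q_def by (rule real_sqrt_ge_zero[OF k01(1)])
    moreover have "q \<le> 1"
      unfolding q_def by (rule real_le_lsqrt) (use k01 in simp_all)
    ultimately have "1 \<le> 2 / (1 + q)"
      by (simp add: le_divide_eq)
    then show ?thesis
      using a unfolding q_def[symmetric] by (intro mult_nonneg_nonneg ln_ge_zero) linarith+
  qed
  have t4: "(1 - 2 * a) * ln (1 - 1 / real k) \<le> (1 - 2 * a) * (- s\<^sup>2)"
  proof -
    have "ln (1 - s\<^sup>2) \<le> - s\<^sup>2"
      using ln_le_minus_one[of "1 - s\<^sup>2"] s(1,2) s2 by simp
    then show ?thesis
      using a unfolding s(3)[symmetric] by (intro mult_left_mono) auto
  qed
  have "twin_expr k a \<le> 2 * a - 2 * a\<^sup>2 - 2 * s * (2 * \<beta> - e) - (1 - 2 * a) * s\<^sup>2"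
  proof -
    have "twin_expr k a = (1 - 2 * a) * ln (1 / (1 - 2 * a)) - a * ln (a\<^sup>2 * real k)
        - 2 * a * ln (2 / (1 + sqrt (1 - 1 / real k))) + (1 - 2 * a) * ln (1 - 1 / real k)"
      using a by (simp only: twin_expr_def) simp
    then show ?thesis
      using t1 t2 t3 t4 by linarith
  qed
  also have "\<dots> = s * (2 * e - 2 * \<beta> - s - 2 * s * \<beta>\<^sup>2 + 2 * s\<^sup>2 * \<beta>)"
    by (simp add: a_def power2_eq_square algebra_simps)
  also have "\<dots> < 0"
  proof -
    define d where "d = b * s + c * s\<^sup>2"
    have \<beta>d: "\<beta> = e + d"
      by (simp add: \<beta>_def d_def)
    \<comment> \<open>The square of \<open>d\<close> is dropped here, and below the positive part
      \<open>c * s\<^sup>2\<close> of \<open>d\<close> inside \<open>e * d\<close>.\<close>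
    have "\<beta>\<^sup>2 \<ge> e\<^sup>2 + 2 * e * d"
      by (simp add: \<beta>d power2_eq_square algebra_simps)
    then have "2 * s * \<beta>\<^sup>2 \<ge> 2 * s * (e\<^sup>2 + 2 * e * d)"
      using s by (intro mult_left_mono) auto
    moreover have "e * d \<ge> e * (b * s)"
      using e cs by (intro mult_left_mono) (auto simp: d_def)
    then have "4 * s * (e * d) \<ge> 4 * s * (e * (b * s))"
      using s by (auto intro: mult_left_mono)
    moreover have "2 * s\<^sup>2 * \<beta> \<le> 2 * s\<^sup>2 * e + s\<^sup>2 * 1"
    proof -
      have "d \<le> 1/2" using bs cs s s2 by (simp add: d_def)
      then have "s\<^sup>2 * d \<le> s\<^sup>2 * (1/2)" by (intro mult_left_mono) auto
      then show ?thesis by (simp add: \<beta>d algebra_simps)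
    qed
    ultimately have "2 * e - 2 * \<beta> - s - 2 * s * \<beta>\<^sup>2 + 2 * s\<^sup>2 * \<beta> \<le>
        - 2 * d - s - 2 * s * e\<^sup>2 - 4 * s * (e * (b * s)) + 2 * s\<^sup>2 * e + s\<^sup>2"
      by (simp add: \<beta>d algebra_simps)
    \<comment> \<open>The terms linear in \<open>s\<close> vanish by the choice of
      \<open>b\<close>.\<close>
    also have "\<dots> = s\<^sup>2 * (- 2 * c - 4 * e * b + 2 * e + 1)"
      by (simp add: d_def b_def power2_eq_square algebra_simps)
    also have "\<dots> = s\<^sup>2 * (- c)"
      by (simp add: b_def c_def algebra_simps)
    also have "\<dots> < 0"
      using mult_pos_neg[of "s\<^sup>2" "- c"] zero_less_power[OF s(1), of 2] c(1) by simp
    finally show ?thesis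
      using s by (simp add: mult_pos_neg)
  qed
  finally show "twin_expr k (s * \<beta>) < 0"
    by (simp add: a_def)
qed

lemma inverse_sqrt_cubed:
  assumes "x > (0::real)"
  shows "x powr (- 3 / 2) = (1 / sqrt x) * (1 / sqrt x)\<^sup>2"
proof -
  have "x powr (- 3 / 2) = x powr (- 1 + - (1 / 2))"
    by simp
  also have "\<dots> = x powr (- 1) * x powr (- (1 / 2))"
    by (rule powr_add)
  also have "\<dots> = (1 / x) * (1 / sqrt x)"
    using assms unfolding powr_minus_divide by (simp add: powr_half_sqrt)
  finally show ?thesis
    using assms by (simp add: power_divide)
qed

lemma LTkn_asymptotic:
  "\<exists>(C::real) (K::nat). \<forall>k\<ge>K. \<forall>\<epsilon>>0. \<forall>\<^sub>F n in sequentially. real (LTkn k n) \<le>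
     (exp 1 / sqrt (real k) - (exp 1 ^ 2 + 1/2) / real k + C * real k powr (-3/2)) * real n
     + \<epsilon> * real n"
proof (intro exI allI impI)
  define e :: real where "e = exp 1"
  define C where "C = 4 * e * (e\<^sup>2 + 1/2) + 2 * e + 1"
  fix k :: nat and \<epsilon> :: real
  \<comment> \<open>The threshold \<open>10 ^ 6\<close> is what makes
    \<open>s \<le> 1 / 1000\<close>.\<close>
  assume k: "10 ^ 6 \<le> k" and \<epsilon>: "\<epsilon> > 0"
  define s where "s = 1 / sqrt (real k)"
  have k0: "real k \<ge> 1000\<^sup>2"
    using k by simp
  then have "sqrt (real k) \<ge> 1000"
    by (rule real_le_rsqrt)
  then have s: "0 < s" "s \<le> 1 / 1000" "s\<^sup>2 = 1 / real k"
    using k by (simp_all add: s_def power_divide frac_le)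
  define a where "a = s * (e + - (e\<^sup>2 + 1 / 2) * s + C * s\<^sup>2)"
  have "twin_expr k a < 0" "1 / real k \<le> a" "a < 1 / 2"
    using twin_expr_neg_large[OF s] unfolding a_def e_def C_def by simp_all
  then have "\<forall>\<^sub>F n in sequentially. real (LTkn k n) \<le> a * real n"
    using k by (intro eventually_LTkn_le_strict) auto
  moreover have "a = e / sqrt (real k) - (e\<^sup>2 + 1/2) / real k + C * real k powr (-3/2)"
  proof -
    have "real k powr (-3/2) = s * s\<^sup>2"
      using inverse_sqrt_cubed[of "real k"] k0 unfolding s_def by simp
    moreover have "e / sqrt (real k) = e * s"
      by (simp add: s_def)
    moreover have "(e\<^sup>2 + 1/2) / real k = (e\<^sup>2 + 1/2) * s\<^sup>2"
      by (simp add: s(3))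
    ultimately show ?thesis
      by (simp add: a_def algebra_simps power2_eq_square)
  qed
  ultimately show "\<forall>\<^sub>F n in sequentially. real (LTkn k n) \<le>
     (exp 1 / sqrt (real k) - (exp 1 ^ 2 + 1/2) / real k
       + (4 * exp 1 * ((exp 1)\<^sup>2 + 1/2) + 2 * exp 1 + 1) * real k powr (-3/2)) * real n
     + \<epsilon> * real n"
    using \<epsilon> unfolding e_def C_def by (auto elim!: eventually_mono intro: add_increasing2)
qed

theorem theorem4:
  shows "(\<forall>(k::nat) (a::real). k \<ge> 2 \<and> 1 / real k \<le> a \<and> a \<le> 1/2 \<and> twin_expr k a < 0 \<longrightarrow>
            (\<forall>\<^sub>F n in sequentially. real (LTkn k n) \<le> a * real n))
       \<and> (\<forall>\<^sub>F n in sequentially. real (LTkn 4 n) \<le> 0.4932 * real n)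
       \<and> (\<forall>\<^sub>F n in sequentially. real (LTkn 5 n) \<le> 0.48 * real n)
       \<and> (\<exists>(C::real) (K::nat). \<forall>k\<ge>K. \<forall>\<epsilon>>0.
            \<forall>\<^sub>F n in sequentially. real (LTkn k n) \<le>
              (exp 1 / sqrt (real k) - (exp 1 ^ 2 + 1/2) / real k + C * real k powr (-3/2)) * real n
              + \<epsilon> * real n)"
proof (intro conjI allI impI)
  fix k :: nat and a :: real
  assume "k \<ge> 2 \<and> 1 / real k \<le> a \<and> a \<le> 1/2 \<and> twin_expr k a < 0"
  then show "\<forall>\<^sub>F n in sequentially. real (LTkn k n) \<le> a * real n"
    by (intro eventually_LTkn_le) auto
next
  show "\<forall>\<^sub>F n in sequentially. real (LTkn 4 n) \<le> 0.4932 * real n"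
    by (rule eventually_LTkn_le) (use twin_expr_4 in simp_all)
next
  show "\<forall>\<^sub>F n in sequentially. real (LTkn 5 n) \<le> 0.48 * real n"
    by (rule eventually_LTkn_le) (use twin_expr_5 in simp_all)
qed (fact LTkn_asymptotic)

end
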